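(* Consider $N$ agents with dynamics $x_i^{t+1}=A_ix_i^t+B_iu_i^t+w_i^t$, $w_i^t\in\mathcal{W}_i$, in closed loop with the robust receding horizon game controller described in the context (tube-tightened constraints, Riccati-based terminal cost and terminal control law, decoupled terminal sets $\mathcal{S}_i^f$). Let $\mathcal{D}(x^t)$ denote the joint feasible set of the receding horizon game at the joint state $x^t=\mathrm{col}(x_i^t)_{i\in\mathcal{A}}$. Suppose $\mathcal{D}(x^0)\neq\emptyset$. Then the receding horizon game remains feasible, i.e. $\mathcal{D}(x^t)\neq\emptyset$, for every $t\ge 0$ and every disturbance realization $w_i^t\in\mathcal{W}_i$, $i\in\mathcal{A}$, $t\geq 0$.
   Context: Agents and graph. $\mathcal{A}=\{1,\dots,N\}$ is the set of agents, the nodes of a connected undirected graph; $\mathcal{N}_i\subseteq\mathcal{A}$ is the set of neighbors of $i$, including $i$ itself. Agent $i$ has state $x_i^t\in\mathbb{R}^{n_x}$, input $u_i^t\in\mathbb{R}^{n_u}$ and dynamics $x_i^{t+1}=A_ix_i^t+B_iu_i^t+w_i^t$ with $w_i^t\in\mathcal{W}_i$. Data: private constraint sets $\mathcal{X}_i\subset\mathbb{R}^{n_x}$, $\mathcal{U}_i\subset\mathbb{R}^{n_u}$; matrices $F_i\in\mathbb{R}^{n_c\times n_x}$, $G_i\in\mathbb{R}^{n_c\times n_u}$ and vectors $b_i\in\mathbb{R}^{n_c}$ of the shared constraints $\sum_{j\in\mathcal{N}_i}(F_jx_j+G_ju_j)\le b_i$; weights $Q_i,R_i$. All vector inequalities and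 minima are componentwise; $\|x\|_Q^2:=x^\top Qx$; $\oplus$ and $\ominus$ are Minkowski sum and Pontryagin difference. Standing assumptions. For each $i$: $\mathcal{W}_i$ is compact and convex with $0\in\mathrm{int}(\mathcal{W}_i)$; $\mathcal{X}_i,\mathcal{U}_i$ are nonempty, compact and convex; $(A_i,B_i)$ is stabilizable; $Q_i,R_i$ are symmetric positive definite. Tightening. $K_i^p$ is a gain such that $\Phi_i^p:=A_i+B_iK_i^p$ is Schur stable. $\mathcal{Z}_i^\infty:=\bigoplus_{n=0}^\infty(\Phi_i^p)^n\mathcal{W}_i$ is the minimal robust positively invariant set: it is compact and $\Phi_i^pe+w\in\mathcal{Z}_i^\infty$ for all $e\in\mathcal{Z}_i^\infty$, $w\in\mathcal{W}_i$. Put $\mathcal{S}_i:=\mathcal{X}_i\ominus\mathcal{Z}_i^\infty$, $\mathcal{V}_i:=\mathcal{U}_i\ominus K_i^p\mathcal{Z}_i^\infty$. With $c_{j,\ell}^\top$ the $\ell$-th row of $F_j+G_jK_j^p$, let $d_j\in\mathbb{R}^{n_c}$, $[d_j]_\ell:=\max_{e\in\mathcal{Z}_j^\infty}c_{j,\ell}^\top e$, and $\bar b_i:=b_i-\sum_{j\in\mathcal{N}_i}d_j$. Steady-state vGNE. For each $i$, $\tilde l_i^p:\mathbb{R}^{n_x}\times\mathbb{R}^{n_u}\to\mathbb{R}$ is continuously differentiable and strongly convex. Let $\mathcal{Z}$ be the set of $z=\mathrm{col}(s_i,v_i)_{i\in\mathcal{A}}$ such that for all $i$: $s_i=A_is_i+B_iv_i$,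 $s_i\in\mathcal{S}_i$, $v_i\in\mathcal{V}_i$, $\sum_{j\in\mathcal{N}_i}(F_js_j+G_jv_j)\le\bar b_i$. $\mathcal{Z}$ is assumed nonempty. The steady-state vGNE $z^*=\mathrm{col}(s_i^*,v_i^* )_i\in\mathcal{Z}$ is the (unique) solution of the variational inequality $\mathrm{col}(\nabla\tilde l_i^p(s_i^*,v_i^* ))_i^\top(z-z^* )\ge0$ for all $z\in\mathcal{Z}$. Terminal ingredients. $P_i\succ0$ is the unique stabilizing solution of $P_i=Q_i+A_i^\top P_iA_i-A_i^\top P_iB_i(R_i+B_i^\top P_iB_i)^{-1}B_i^\top P_iA_i$; $K_i^f:=-(R_i+B_i^\top P_iB_i)^{-1}B_i^\top P_iA_i$; $\kappa_i(s_i):=v_i^*+K_i^f(s_i-s_i^* )$; $l_i^f(s_i):=\|s_i-s_i^*\|_{P_i}^2$. Shares: for $j\in\mathcal{N}_i$, $\alpha_j^{(i)}:=F_js_j^*+G_jv_j^*+\frac{1}{|\mathcal{N}_i|}\big[\bar b_i-\sum_{k\in\mathcal{N}_i}(F_ks_k^*+G_kv_k^* )\big]$; $\mathcal{M}_j:=\{i\in\mathcal{A}:j\in\mathcal{N}_i\}$; $\alpha_j:=\min_{i\in\mathcal{M}_j}\alpha_j^{(i)}$. The terminal set $\mathcal{S}_i^f$ is the largest set $\mathcal{S}_i^f\subseteq\mathcal{S}_i$ such that every $s_i\in\mathcal{S}_i^f$ satisfies $\kappa_i(s_i)\in\mathcal{V}_i$, $F_is_i+G_i\kappa_i(s_i)\le\alpha_i$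 and $A_is_i+B_i\kappa_i(s_i)\in\mathcal{S}_i^f$. Receding horizon game. $H\ge1$ is the horizon. Let $z_i^t=(s_i^{0|t},\dots,s_i^{H|t},v_i^{0|t},\dots,v_i^{H-1|t})$ and $z^t=\mathrm{col}(z_i^t)_i$. Agent $i$ minimizes $J_i(z_i^t):=\sum_{k=0}^{H-1}l_i^p(s_i^{k|t},v_i^{k|t})+l_i^f(s_i^{H|t})$, where $l_i^p(s_i,v_i):=\|s_i-s_i^*\|_{Q_i}^2+\|v_i-v_i^*\|_{R_i}^2$. The joint feasible set $\mathcal{D}(x^t)$ is the set of all $z^t$ such that for all $i\in\mathcal{A}$ and $k=0,\dots,H-1$: $s_i^{k+1|t}=A_is_i^{k|t}+B_iv_i^{k|t}$; $s_i^{k|t}\in\mathcal{S}_i$, $v_i^{k|t}\in\mathcal{V}_i$; $\sum_{j\in\mathcal{N}_i}(F_js_j^{k|t}+G_jv_j^{k|t})\le\bar b_i$; and moreover $s_i^{H|t}\in\mathcal{S}_i^f$ and $x_i^t-s_i^{0|t}\in\mathcal{Z}_i^\infty$. Closed loop. When $\mathcal{D}(x^t)\ne\emptyset$, $z^{*,t}=(s_i^{*,0|t},\dots,s_i^{*,H|t},v_i^{*,0|t},\dots,v_i^{*,H-1|t})_{i\in\mathcal{A}}\in\mathcal{D}(x^t)$ denotes the vGNE at time $t$, i.e. the (unique) solution of $\mathrm{col}(\nabla J_i(z_i^{*,t}))_i^\top(z-z^{*,t})\ge0$ for all $z\in\mathcal{D}(x^t)$. Each agent then applies $u_i^t=v_i^{*,0|t}+K_i^p(x_i^t-s_i^{*,0|t})$,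 and $x_i^{t+1}=A_ix_i^t+B_iu_i^t+w_i^t$. *)

theory Defs
  imports "HOL-Analysis.Analysis"
begin

section \<open>General notions\<close>

definition schur_stable :: "real^'n^'n \<Rightarrow> bool" where
  "schur_stable M \<longleftrightarrow>
     (\<forall>(\<mu>::complex) v. v \<noteq> 0 \<and> map_matrix complex_of_real M *v v = \<mu> *s v \<longrightarrow> norm \<mu> < 1)"

definition stabilizable :: "real^'n^'n \<Rightarrow> real^'m^'n \<Rightarrow> bool" where
  "stabilizable A B \<longleftrightarrow> (\<exists>K. schur_stable (A + B ** K))"

definition sym_pos_def :: "real^'n^'n \<Rightarrow> bool" where
  "sym_pos_def M \<longleftrightarrow> transpose M = M \<and> (\<forall>v. v \<noteq> 0 \<longrightarrow> v \<bullet> (M *v v) > 0)"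

definition wnorm_sq :: "real^'n^'n \<Rightarrow> real^'n \<Rightarrow> real" where
  "wnorm_sq M v = v \<bullet> (M *v v)"

definition gradient :: "('v::real_inner \<Rightarrow> real) \<Rightarrow> 'v \<Rightarrow> 'v" where
  "gradient f p = (THE D. GDERIV f p :> D)"

definition cont_differentiable :: "('v::real_inner \<Rightarrow> real) \<Rightarrow> bool" where
  "cont_differentiable f \<longleftrightarrow> (\<exists>D. (\<forall>p. GDERIV f p :> D p) \<and> continuous_on UNIV D)"

definition strongly_convex :: "('v::real_inner \<Rightarrow> real) \<Rightarrow> bool" where
  "strongly_convex f \<longleftrightarrow> (\<exists>m>0. \<forall>p q. \<forall>\<theta>\<in>{0..1}.
     f (\<theta> *\<^sub>R p + (1 - \<theta>) *\<^sub>R q)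
       \<le> \<theta> * f p + (1 - \<theta>) * f q - m / 2 * \<theta> * (1 - \<theta>) * (norm (p - q))\<^sup>2)"

definition pontryagin_diff :: "'v::real_vector set \<Rightarrow> 'v set \<Rightarrow> 'v set" where
  "pontryagin_diff C D = {v. \<forall>d\<in>D. v + d \<in> C}"

text \<open>The infinite Minkowski sum: all convergent series with \<open>n\<close>-th term in \<open>C n\<close>.\<close>

definition minkowski_series :: "(nat \<Rightarrow> 'v::real_normed_vector set) \<Rightarrow> 'v set" where
  "minkowski_series C = {e. \<exists>c. (\<forall>n. c n \<in> C n) \<and> c sums e}"


section \<open>Problem data\<close>

text \<open>
  The finite type \<open>'a\<close> is the set of agents; \<open>'x\<close>, \<open>'u\<close>, \<open>'c\<close> index the coordinates of states,
  inputs and shared constraints. \<open>Kp\<close> is the tube gain, \<open>l_tilde\<close> the stage cost whose steady-state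
  equilibrium is \<open>z_star\<close>, and \<open>P_mat\<close> the Riccati matrix; the conditions that determine \<open>z_star\<close>
  and \<open>P_mat\<close> are \<open>steady_vgne\<close> and \<open>stabilizing_riccati\<close> below.
\<close>

record ('a, 'x::finite, 'u::finite, 'c::finite) rhg =
  edges :: "('a \<times> 'a) set"
  A_mat :: "'a \<Rightarrow> real^'x^'x"
  B_mat :: "'a \<Rightarrow> real^'u^'x"
  W_set :: "'a \<Rightarrow> (real^'x) set"
  X_set :: "'a \<Rightarrow> (real^'x) set"
  U_set :: "'a \<Rightarrow> (real^'u) set"
  F_mat :: "'a \<Rightarrow> real^'x^'c"
  G_mat :: "'a \<Rightarrow> real^'u^'c"
  b_vec :: "'a \<Rightarrow> real^'c"
  Q_mat :: "'a \<Rightarrow> real^'x^'x"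
  R_mat :: "'a \<Rightarrow> real^'u^'u"
  Kp :: "'a \<Rightarrow> real^'x^'u"
  l_tilde :: "'a \<Rightarrow> (real^'x) \<times> (real^'u) \<Rightarrow> real"
  z_star :: "'a \<Rightarrow> (real^'x) \<times> (real^'u)"
  P_mat :: "'a \<Rightarrow> real^'x^'x"
  horizon :: nat

definition nbrs :: "('a, 'x::finite, 'u::finite, 'c::finite) rhg \<Rightarrow> 'a \<Rightarrow> 'a set" where
  "nbrs g i = insert i {j. (i, j) \<in> edges g}"


section \<open>Constraint tightening\<close>

definition Phi :: "('a, 'x::finite, 'u::finite, 'c::finite) rhg \<Rightarrow> 'a \<Rightarrow> real^'x^'x" where
  "Phi g i = A_mat g i + B_mat g i ** Kp g i"

definition Z_inf :: "('a, 'x::finite, 'u::finite, 'c::finite) rhg \<Rightarrow> 'a \<Rightarrow> (real^'x) set" where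
  "Z_inf g i = minkowski_series (\<lambda>n. (((*v) (Phi g i)) ^^ n) ` W_set g i)"

definition S_set :: "('a, 'x::finite, 'u::finite, 'c::finite) rhg \<Rightarrow> 'a \<Rightarrow> (real^'x) set" where
  "S_set g i = pontryagin_diff (X_set g i) (Z_inf g i)"

definition V_set :: "('a, 'x::finite, 'u::finite, 'c::finite) rhg \<Rightarrow> 'a \<Rightarrow> (real^'u) set" where
  "V_set g i = pontryagin_diff (U_set g i) ((*v) (Kp g i) ` Z_inf g i)"

text \<open>The supremum below is a maximum, since \<open>Z_inf g j\<close> is compact when \<open>Phi g j\<close> is Schur stable.\<close>

definition d_vec :: "('a, 'x::finite, 'u::finite, 'c::finite) rhg \<Rightarrow> 'a \<Rightarrow> real^'c" where
  "d_vec g j = (\<chi> l. SUP e\<in>Z_inf g j. row l (F_mat g j + G_mat g j ** Kp g j) \<bullet> e)"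

definition b_bar :: "('a, 'x::finite, 'u::finite, 'c::finite) rhg \<Rightarrow> 'a \<Rightarrow> real^'c" where
  "b_bar g i = b_vec g i - (\<Sum>j\<in>nbrs g i. d_vec g j)"


section \<open>Steady-state equilibrium\<close>

definition steady_set ::
  "('a, 'x::finite, 'u::finite, 'c::finite) rhg \<Rightarrow> ('a \<Rightarrow> (real^'x) \<times> (real^'u)) set" where
  "steady_set g = {z. \<forall>i.
     fst (z i) = A_mat g i *v fst (z i) + B_mat g i *v snd (z i) \<and>
     fst (z i) \<in> S_set g i \<and> snd (z i) \<in> V_set g i \<and>
     (\<Sum>j\<in>nbrs g i. F_mat g j *v fst (z j) + G_mat g j *v snd (z j)) \<le> b_bar g i}"

definition steady_vgne :: "('a::finite, 'x::finite, 'u::finite, 'c::finite) rhg \<Rightarrow> bool" where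
  "steady_vgne g \<longleftrightarrow> z_star g \<in> steady_set g \<and>
     (\<forall>z\<in>steady_set g. (\<Sum>i\<in>UNIV. gradient (l_tilde g i) (z_star g i) \<bullet> (z i - z_star g i)) \<ge> 0)"

definition s_star :: "('a, 'x::finite, 'u::finite, 'c::finite) rhg \<Rightarrow> 'a \<Rightarrow> real^'x" where
  "s_star g i = fst (z_star g i)"

definition v_star :: "('a, 'x::finite, 'u::finite, 'c::finite) rhg \<Rightarrow> 'a \<Rightarrow> real^'u" where
  "v_star g i = snd (z_star g i)"


section \<open>Terminal ingredients\<close>

definition Kf :: "('a, 'x::finite, 'u::finite, 'c::finite) rhg \<Rightarrow> 'a \<Rightarrow> real^'x^'u" where
  "Kf g i = - (matrix_inv (R_mat g i + transpose (B_mat g i) ** P_mat g i ** B_mat g i)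
               ** transpose (B_mat g i) ** P_mat g i ** A_mat g i)"

definition stabilizing_riccati ::
  "('a, 'x::finite, 'u::finite, 'c::finite) rhg \<Rightarrow> 'a \<Rightarrow> bool" where
  "stabilizing_riccati g i \<longleftrightarrow>
     sym_pos_def (P_mat g i) \<and>
     P_mat g i = Q_mat g i + transpose (A_mat g i) ** P_mat g i ** A_mat g i
       - transpose (A_mat g i) ** P_mat g i ** B_mat g i
         ** matrix_inv (R_mat g i + transpose (B_mat g i) ** P_mat g i ** B_mat g i)
         ** transpose (B_mat g i) ** P_mat g i ** A_mat g i \<and>
     schur_stable (A_mat g i + B_mat g i ** Kf g i)"

definition kappa ::
  "('a, 'x::finite, 'u::finite, 'c::finite) rhg \<Rightarrow> 'a \<Rightarrow> real^'x \<Rightarrow> real^'u" where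
  "kappa g i s = v_star g i + Kf g i *v (s - s_star g i)"

definition l_f :: "('a, 'x::finite, 'u::finite, 'c::finite) rhg \<Rightarrow> 'a \<Rightarrow> real^'x \<Rightarrow> real" where
  "l_f g i s = wnorm_sq (P_mat g i) (s - s_star g i)"

text \<open>\<open>share g i j\<close> is the share of agent \<open>j\<close> in the shared constraint of agent \<open>i\<close>.\<close>

definition share :: "('a, 'x::finite, 'u::finite, 'c::finite) rhg \<Rightarrow> 'a \<Rightarrow> 'a \<Rightarrow> real^'c" where
  "share g i j = F_mat g j *v s_star g j + G_mat g j *v v_star g j
     + (1 / real (card (nbrs g i))) *\<^sub>R
       (b_bar g i - (\<Sum>k\<in>nbrs g i. F_mat g k *v s_star g k + G_mat g k *v v_star g k))"

definition alpha :: "('a, 'x::finite, 'u::finite, 'c::finite) rhg \<Rightarrow> 'a \<Rightarrow> real^'c" where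
  "alpha g j = (\<chi> l. Min ((\<lambda>i. share g i j $ l) ` {i. j \<in> nbrs g i}))"

definition terminal_admissible ::
  "('a, 'x::finite, 'u::finite, 'c::finite) rhg \<Rightarrow> 'a \<Rightarrow> (real^'x) set \<Rightarrow> bool" where
  "terminal_admissible g i T \<longleftrightarrow> T \<subseteq> S_set g i \<and>
     (\<forall>s\<in>T. kappa g i s \<in> V_set g i \<and>
             F_mat g i *v s + G_mat g i *v kappa g i s \<le> alpha g i \<and>
             A_mat g i *v s + B_mat g i *v kappa g i s \<in> T)"

definition S_f :: "('a, 'x::finite, 'u::finite, 'c::finite) rhg \<Rightarrow> 'a \<Rightarrow> (real^'x) set" where
  "S_f g i = (GREATEST T. terminal_admissible g i T)"

lemma terminal_admissible_S_f: "terminal_admissible g i (S_f g i)"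
  and S_f_greatest: "terminal_admissible g i T \<Longrightarrow> T \<subseteq> S_f g i"
proof -
  let ?M = "\<Union>{T. terminal_admissible g i T}"
  have adm: "terminal_admissible g i ?M"
    unfolding terminal_admissible_def by blast
  have eq: "S_f g i = ?M"
    unfolding S_f_def by (rule Greatest_equality) (use adm in auto)
  show "terminal_admissible g i (S_f g i)"
    using adm eq by simp
  show "T \<subseteq> S_f g i" if "terminal_admissible g i T"
    using that eq by auto
qed


section \<open>Receding horizon game\<close>

text \<open>
  A plan \<open>(s, v)\<close> of one agent stands for the finite vector
  \<open>(s 0, \<dots>, s H, v 0, \<dots>, v (H - 1))\<close>; entries beyond the horizon are set to zero in the
  feasible set, so that plans correspond exactly to such vectors.
\<close>

type_synonym ('x, 'u) plan = "(nat \<Rightarrow> real^'x) \<times> (nat \<Rightarrow> real^'u)"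

definition l_p ::
  "('a, 'x::finite, 'u::finite, 'c::finite) rhg \<Rightarrow> 'a \<Rightarrow> real^'x \<Rightarrow> real^'u \<Rightarrow> real" where
  "l_p g i s v = wnorm_sq (Q_mat g i) (s - s_star g i) + wnorm_sq (R_mat g i) (v - v_star g i)"

definition J ::
  "('a, 'x::finite, 'u::finite, 'c::finite) rhg \<Rightarrow> 'a \<Rightarrow> ('x, 'u) plan \<Rightarrow> real" where
  "J g i p = (\<Sum>k<horizon g. l_p g i (fst p k) (snd p k)) + l_f g i (fst p (horizon g))"

definition feasible ::
  "('a, 'x::finite, 'u::finite, 'c::finite) rhg \<Rightarrow> ('a \<Rightarrow> real^'x) \<Rightarrow> ('a \<Rightarrow> ('x, 'u) plan) set" where
  "feasible g x = {z. \<forall>i.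
     (\<forall>k<horizon g.
        fst (z i) (Suc k) = A_mat g i *v fst (z i) k + B_mat g i *v snd (z i) k \<and>
        fst (z i) k \<in> S_set g i \<and> snd (z i) k \<in> V_set g i \<and>
        (\<Sum>j\<in>nbrs g i. F_mat g j *v fst (z j) k + G_mat g j *v snd (z j) k) \<le> b_bar g i) \<and>
     fst (z i) (horizon g) \<in> S_f g i \<and>
     x i - fst (z i) 0 \<in> Z_inf g i \<and>
     (\<forall>k>horizon g. fst (z i) k = 0) \<and> (\<forall>k\<ge>horizon g. snd (z i) k = 0)}"

text \<open>
  The inner product of the gradient of \<open>J g i\<close> at \<open>p\<close> with \<open>q - p\<close>, where the gradient with
  respect to the stacked vector is the stack of the gradients with respect to its blocks.
\<close>

definition grad_J_inner ::
  "('a, 'x::finite, 'u::finite, 'c::finite) rhg \<Rightarrow> 'a \<Rightarrow> ('x, 'u) plan \<Rightarrow> ('x, 'u) plan \<Rightarrow> real" where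
  "grad_J_inner g i p q =
     (\<Sum>k\<le>horizon g.
        gradient (\<lambda>y. J g i ((fst p)(k := y), snd p)) (fst p k) \<bullet> (fst q k - fst p k)) +
     (\<Sum>k<horizon g.
        gradient (\<lambda>y. J g i (fst p, (snd p)(k := y))) (snd p k) \<bullet> (snd q k - snd p k))"

definition vgne ::
  "('a::finite, 'x::finite, 'u::finite, 'c::finite) rhg \<Rightarrow> ('a \<Rightarrow> real^'x)
    \<Rightarrow> ('a \<Rightarrow> ('x, 'u) plan) \<Rightarrow> bool" where
  "vgne g x z \<longleftrightarrow> z \<in> feasible g x \<and>
     (\<forall>z'\<in>feasible g x. (\<Sum>i\<in>UNIV. grad_J_inner g i (z i) (z' i)) \<ge> 0)"

end

theory Submission
  imports Defs
begin

text \<open>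
  Recursive feasibility by the shifted candidate: drop the first stage of the equilibrium plan and
  append one step of the terminal control law. The tube error evolves as \<open>e \<mapsto> \<Phi> e + w\<close>, which
  leaves the infinite Minkowski sum invariant; the appended stage satisfies the shared constraints
  because the local bounds \<open>alpha\<close> add up to at most \<open>b_bar\<close> over each neighborhood.
\<close>

text \<open>Applying \<open>Phi g i\<close> termwise to a series for \<open>e\<close> moves the
  \<open>n\<close>-th term into the \<open>(n+1)\<close>-st summand set, which leaves slot 0 free
  for \<open>w\<close>. A bounded linear map preserves the convergence.\<close>

lemma Z_inf_invariant:
  assumes "e \<in> Z_inf g i" and "w \<in> W_set g i"
  shows "Phi g i *v e + w \<in> Z_inf g i"
proof -
  let ?f = "(*v) (Phi g i)"
  obtain c where c: "c n \<in> (?f ^^ n) ` W_set g i" and sums: "c sums e" for n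
    using assms(1) by (auto simp: Z_inf_def minkowski_series_def)
  define c' where "c' = case_nat w (\<lambda>n. ?f (c n))"
  have "(\<lambda>n. ?f (c n)) sums ?f e"
    by (rule bounded_linear.sums[OF matrix_vector_mul_bounded_linear sums])
  then have "c' sums (?f e + w)"
    using sums_Suc_iff[of c' "?f e"] by (simp add: c'_def)
  moreover have "c' n \<in> (?f ^^ n) ` W_set g i" for n
  proof (cases n)
    case 0
    then show ?thesis
      using assms(2) by (simp add: c'_def)
  next
    case (Suc m)
    obtain v where "v \<in> W_set g i" "c m = (?f ^^ m) v"
      using c by blast
    then show ?thesis
      using Suc by (auto simp: c'_def)
  qed
  ultimately show ?thesis
    by (auto simp: Z_inf_def minkowski_series_def)
qed

text \<open>Each \<open>alpha g j\<close> is a minimum over all constraints in which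
  \<open>j\<close> takes part, hence at most the share of \<open>j\<close> in constraint
  \<open>i\<close>. The shares of constraint \<open>i\<close> split its slack at the steady state
  equally, so they add up exactly to \<open>b_bar g i\<close>.\<close>

lemma sum_alpha_le_b_bar:
  fixes g :: "('a::finite, 'x::finite, 'u::finite, 'c::finite) rhg"
  shows "(\<Sum>j\<in>nbrs g i. alpha g j) \<le> b_bar g i"
proof -
  have "card (nbrs g i) \<noteq> 0"
    by (simp add: nbrs_def)
  have "(\<Sum>j\<in>nbrs g i. alpha g j) \<le> (\<Sum>j\<in>nbrs g i. share g i j)"
    by (intro sum_mono) (auto simp: less_eq_vec_def alpha_def intro!: Min_le)
  also have "\<dots> = b_bar g i"
    using \<open>card (nbrs g i) \<noteq> 0\<close>
    by (simp add: share_def sum.distrib sum_constant_scaleR del: sum_constant)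
  finally show ?thesis .
qed

text \<open>Inputs stop one index before states, so the terminal law is the input at
  \<open>H - 1\<close> and produces the state at \<open>H\<close>. The zeros beyond match the
  padding that \<open>feasible\<close> demands.\<close>

definition shifted_plan ::
  "('a, 'x::finite, 'u::finite, 'c::finite) rhg \<Rightarrow> 'a \<Rightarrow> ('x, 'u) plan \<Rightarrow> ('x, 'u) plan" where
  "shifted_plan g i p = (let H = horizon g; s = fst p H in
     (\<lambda>k. if k < H then fst p (Suc k)
          else if k = H then A_mat g i *v s + B_mat g i *v kappa g i s else 0,
      \<lambda>k. if Suc k < H then snd p (Suc k) else if Suc k = H then kappa g i s else 0))"

lemma shifted_plan_feasible:
  fixes g :: "('a::finite, 'x::finite, 'u::finite, 'c::finite) rhg"
  assumes z: "z \<in> feasible g x"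
    and horizon: "horizon g \<ge> 1"
    and w: "\<And>i. w i \<in> W_set g i"
    and u: "\<And>i. u i = snd (z i) 0 + Kp g i *v (x i - fst (z i) 0)"
  shows "(\<lambda>i. shifted_plan g i (z i)) \<in> feasible g (\<lambda>i. A_mat g i *v x i + B_mat g i *v u i + w i)"
proof -
  let ?H = "horizon g" and ?p = "\<lambda>i. shifted_plan g i (z i)"
  let ?s = "\<lambda>i. fst (z i) (horizon g)"
  have dyn: "fst (z i) (Suc k) = A_mat g i *v fst (z i) k + B_mat g i *v snd (z i) k"
    and S: "fst (z i) k \<in> S_set g i" and V: "snd (z i) k \<in> V_set g i"
    and shared: "(\<Sum>j\<in>nbrs g i. F_mat g j *v fst (z j) k + G_mat g j *v snd (z j) k) \<le> b_bar g i"
    if "k < ?H" for i k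
    using z that unfolding feasible_def by auto
  have term_mem: "?s i \<in> S_f g i" and err: "x i - fst (z i) 0 \<in> Z_inf g i" for i
    using z unfolding feasible_def by auto
  \<comment> \<open>The stage constraints in \<open>feasible\<close> end before index
    \<open>H\<close>; at the old terminal state their role is taken by the properties of
    \<open>S_f\<close>.\<close>
  have S_H: "?s i \<in> S_set g i" and V_H: "kappa g i (?s i) \<in> V_set g i"
    and alpha_H: "F_mat g i *v ?s i + G_mat g i *v kappa g i (?s i) \<le> alpha g i"
    and next_H: "A_mat g i *v ?s i + B_mat g i *v kappa g i (?s i) \<in> S_f g i" for i
    using terminal_admissible_S_f[of g i] term_mem[of i]
    unfolding terminal_admissible_def by auto
  have fst_p: "fst (?p i) k = fst (z i) (Suc k)" if "k < ?H" for i k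
    using that by (simp add: shifted_plan_def Let_def)
  have snd_p: "snd (?p i) k = snd (z i) (Suc k)" if "Suc k < ?H" for i k
    using that by (simp add: shifted_plan_def Let_def)
  have fst_H: "fst (?p i) ?H = A_mat g i *v ?s i + B_mat g i *v kappa g i (?s i)" for i
    by (simp add: shifted_plan_def Let_def)
  have snd_H: "snd (?p i) k = kappa g i (?s i)" if "Suc k = ?H" for i k
    using that by (simp add: shifted_plan_def Let_def)
  have stage: "fst (?p i) (Suc k) = A_mat g i *v fst (?p i) k + B_mat g i *v snd (?p i) k \<and>
        fst (?p i) k \<in> S_set g i \<and> snd (?p i) k \<in> V_set g i \<and>
        (\<Sum>j\<in>nbrs g i. F_mat g j *v fst (?p j) k + G_mat g j *v snd (?p j) k) \<le> b_bar g i"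
    if "k < ?H" for i k
  proof (cases "Suc k = ?H")
    \<comment> \<open>The appended stage starts at the old terminal state \<open>?s\<close>. Its
      local bounds by \<open>alpha\<close> are summed over the neighborhood to recover the shared
      constraint.\<close>
    case True
    have "(\<Sum>j\<in>nbrs g i. F_mat g j *v ?s j + G_mat g j *v kappa g j (?s j))
        \<le> (\<Sum>j\<in>nbrs g i. alpha g j)"
      by (intro sum_mono alpha_H)
    also have "\<dots> \<le> b_bar g i"
      by (rule sum_alpha_le_b_bar)
    finally show ?thesis
      using True S_H V_H by (simp add: fst_p[OF that] snd_H fst_H)
  next
    \<comment> \<open>Stage \<open>k\<close> of the candidate is stage \<open>Suc k\<close> of the
      old plan, for all agents at once.\<close>
    case False
    with that have "Suc k < ?H" by simp
    then show ?thesis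
      using dyn[of "Suc k" i] S[of "Suc k" i] V[of "Suc k" i] shared[of "Suc k" i] that
      by (simp only: fst_p snd_p simp_thms)
  qed
  \<comment> \<open>The new initial nominal state is the old one propagated by its own input,
    available since the horizon is at least 1. In the difference the nominal inputs cancel and the
    feedback \<open>Kp\<close> turns \<open>A_mat\<close> into \<open>Phi\<close>.\<close>
  have "A_mat g i *v x i + B_mat g i *v u i + w i - fst (?p i) 0
      = Phi g i *v (x i - fst (z i) 0) + w i" for i
    using horizon fst_p[of 0 i] dyn[of 0 i]
    by (simp add: u Phi_def matrix_vector_mult_add_rdistrib matrix_vector_right_distrib
        matrix_vector_mult_diff_distrib matrix_vector_mul_assoc algebra_simps)
  then have error: "A_mat g i *v x i + B_mat g i *v u i + w i - fst (?p i) 0 \<in> Z_inf g i" for i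
    using Z_inf_invariant[OF err w] by (simp only:)
  have "\<forall>k>?H. fst (?p i) k = 0" "\<forall>k\<ge>?H. snd (?p i) k = 0" for i
    by (auto simp: shifted_plan_def Let_def)
  then show ?thesis
    unfolding feasible_def using stage error next_H fst_H by simp
qed

theorem theorem1:
  fixes g :: "('a::finite, 'x::finite, 'u::finite, 'c::finite) rhg"
    and x w :: "nat \<Rightarrow> 'a \<Rightarrow> real^'x"
    and u :: "nat \<Rightarrow> 'a \<Rightarrow> real^'u"
    and z :: "nat \<Rightarrow> 'a \<Rightarrow> ('x, 'u) plan"
  assumes undirected: "sym (edges g)"
    and connected: "\<And>i j. (i, j) \<in> (edges g)\<^sup>*"
    and W: "\<And>i. compact (W_set g i) \<and> convex (W_set g i) \<and> 0 \<in> interior (W_set g i)"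
    and X: "\<And>i. X_set g i \<noteq> {} \<and> compact (X_set g i) \<and> convex (X_set g i)"
    and U: "\<And>i. U_set g i \<noteq> {} \<and> compact (U_set g i) \<and> convex (U_set g i)"
    and stabilizable: "\<And>i. stabilizable (A_mat g i) (B_mat g i)"
    and Q: "\<And>i. sym_pos_def (Q_mat g i)"
    and R: "\<And>i. sym_pos_def (R_mat g i)"
    and Kp: "\<And>i. schur_stable (Phi g i)"
    and l_tilde: "\<And>i. cont_differentiable (l_tilde g i) \<and> strongly_convex (l_tilde g i)"
    and steady_nonempty: "steady_set g \<noteq> {}"
    and steady: "steady_vgne g"
    and riccati: "\<And>i. stabilizing_riccati g i"
    and horizon: "horizon g \<ge> 1"
    and disturbance: "\<And>t i. w t i \<in> W_set g i"
    and dynamics: "\<And>t i. x (Suc t) i = A_mat g i *v x t i + B_mat g i *v u t i + w t i"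
    and equilibrium: "\<And>t. feasible g (x t) \<noteq> {} \<Longrightarrow> vgne g (x t) (z t)"
    and control: "\<And>t i. feasible g (x t) \<noteq> {} \<Longrightarrow>
        u t i = snd (z t i) 0 + Kp g i *v (x t i - fst (z t i) 0)"
    and initially_feasible: "feasible g (x 0) \<noteq> {}"
  shows "\<forall>t. feasible g (x t) \<noteq> {}"
proof
  fix t
  show "feasible g (x t) \<noteq> {}"
  proof (induction t)
    case 0
    show ?case by (rule initially_feasible)
  next
    case (Suc t)
    \<comment> \<open>The equilibrium and the control law are available only at feasible times; the
      induction hypothesis supplies both at \<open>t\<close>.\<close>
    have "z t \<in> feasible g (x t)"
      using equilibrium[OF Suc] by (simp add: vgne_def)
    from shifted_plan_feasible[OF this horizon disturbance control[OF Suc]]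
    have "(\<lambda>i. shifted_plan g i (z t i)) \<in> feasible g (x (Suc t))"
      by (simp add: dynamics[abs_def])
    then show ?case by blast
  qed
qed

end
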